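(* Let $\mathcal H$ be a real Hilbert space, let $\mu\in\,]0,\infty[$, let $n\ge 1$ be an integer, $I=\{1,\dots,n\}$, and let $\lambda_i>0$ ($i\in I$) satisfy $\sum_{i\in I}\lambda_i=1$. For each $i\in I$ let $A_i:\mathcal H\rightrightarrows\mathcal H$ be a set-valued mapping. Write $\mathbf A=(A_1,\dots,A_n)$, $\mathbf A^{-1}=(A_1^{-1},\dots,A_n^{-1})$ and $\boldsymbol\lambda=(\lambda_1,\dots,\lambda_n)$. Then $$\big(\mathcal R_\mu(\mathbf A,\boldsymbol\lambda)\big)^{-1}=\mathcal R_{\mu^{-1}}(\mathbf A^{-1},\boldsymbol\lambda).$$
   Context: For a set-valued mapping $A:\mathcal H\rightrightarrows\mathcal H$ the inverse $A^{-1}:\mathcal H\rightrightarrows\mathcal H$ is the set-valued mapping defined by $x\in A^{-1}u\Leftrightarrow u\in Ax$. Sums and scalar multiples of set-valued mappings are taken pointwise in the Minkowski sense (with value $\varnothing$ where a summand is empty). $\mathrm{Id}$ is the identity on $\mathcal H$. For $\nu\in\,]0,\infty[$ and $\mathbf B=(B_1,\dots,B_n)$ with $B_i:\mathcal H\rightrightarrows\mathcal H$, the $\boldsymbol\lambda$-weighted resolvent average of $\mathbf B$ with parameter $\nu$ is the set-valued mapping $$\mathcal R_\nu(\mathbf B,\boldsymbol\lambda)=\Big(\sum_{i\in I}\lambda_i(B_i+\nu^{-1}\mathrm{Id})^{-1}\Big)^{-1}-\nu^{-1}\mathrm{Id}.$$ *)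

theory Defs
  imports "HOL-Analysis.Analysis" "HOL-Library.Set_Algebras"
begin

text \<open>
  A set-valued mapping from H to H is a function of type \<open>'a \<Rightarrow> 'a set\<close>; the value may be empty.
  On values, \<open>+\<close> and \<open>\<Sum>\<close> are the Minkowski operations of \<^theory>\<open>HOL-Library.Set_Algebras\<close>
  (so a sum with an empty summand is empty). In contrast, \<open>-\<close> on sets is the set-theoretic
  difference, so differences of set-valued mappings are defined here through scaling by \<open>-1\<close>.
\<close>

type_synonym 'a set_valued = "'a \<Rightarrow> 'a set"

definition sv_inverse :: "'a set_valued \<Rightarrow> 'a set_valued" where
  "sv_inverse A = (\<lambda>u. {x. u \<in> A x})"

definition sv_Id :: "'a set_valued" where
  "sv_Id = (\<lambda>x. {x})"

definition sv_plus :: "'a::real_vector set_valued \<Rightarrow> 'a set_valued \<Rightarrow> 'a set_valued" where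
  "sv_plus A B = (\<lambda>x. A x + B x)"

definition sv_scale :: "real \<Rightarrow> 'a::real_vector set_valued \<Rightarrow> 'a set_valued" where
  "sv_scale c A = (\<lambda>x. (\<lambda>u. c *\<^sub>R u) ` A x)"

definition sv_minus :: "'a::real_vector set_valued \<Rightarrow> 'a set_valued \<Rightarrow> 'a set_valued" where
  "sv_minus A B = sv_plus A (sv_scale (-1) B)"

definition sv_sum :: "(nat \<Rightarrow> 'a::real_vector set_valued) \<Rightarrow> nat set \<Rightarrow> 'a set_valued" where
  "sv_sum B I = (\<lambda>x. \<Sum>i\<in>I. B i x)"

text \<open>
  The tuples \<open>(B\<^sub>1, \<dots>, B\<^sub>n)\<close> and \<open>(w\<^sub>1, \<dots>, w\<^sub>n)\<close> are functions on \<^typ>\<open>nat\<close>, of which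
  only the values on \<open>{1..n}\<close> matter.
\<close>

definition resolvent_average ::
  "nat \<Rightarrow> real \<Rightarrow> (nat \<Rightarrow> 'a::real_vector set_valued) \<Rightarrow> (nat \<Rightarrow> real) \<Rightarrow> 'a set_valued" where
  "resolvent_average n \<nu> B w =
     sv_minus
       (sv_inverse
         (sv_sum (\<lambda>i. sv_scale (w i) (sv_inverse (sv_plus (B i) (sv_scale (inverse \<nu>) sv_Id)))) {1..n}))
       (sv_scale (inverse \<nu>) sv_Id)"

end

theory Submission
  imports Defs
begin

text \<open>
  Unfolding the inverses and the Minkowski sums, \<open>y\<close> belongs to the resolvent average with
  parameter \<open>\<nu>\<close> at \<open>x\<close> iff \<open>x\<close> is a weighted mean \<open>\<Sum>i. w\<^sub>i a\<^sub>i\<close> of points \<open>a\<^sub>i\<close> such that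
  \<open>b\<^sub>i = y + \<nu>\<^sup>-\<^sup>1 (x - a\<^sub>i)\<close> lies in \<open>B\<^sub>i a\<^sub>i\<close> for every \<open>i\<close> (lemma
  \<open>mem_resolvent_average_iff\<close>). Since the weights have sum 1, the mean of the \<open>b\<^sub>i\<close> is \<open>y\<close>.
  Moreover \<open>a\<^sub>i = x + \<nu> (y - b\<^sub>i)\<close> and \<open>a\<^sub>i \<in> B\<^sub>i\<^sup>-\<^sup>1 b\<^sub>i\<close>, so the \<open>b\<^sub>i\<close> witness that \<open>x\<close> belongs
  at \<open>y\<close> to the resolvent average of the inverses with parameter \<open>\<nu>\<^sup>-\<^sup>1\<close>. The converse is the
  same implication for the inverses and \<open>\<nu>\<^sup>-\<^sup>1\<close>.
\<close>

lemma mem_sv_inverse_iff: "x \<in> sv_inverse A u \<longleftrightarrow> u \<in> A x"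
  by (simp add: sv_inverse_def)

lemma sv_inverse_sv_inverse: "sv_inverse (sv_inverse A) = A"
  by (simp add: sv_inverse_def)

lemma mem_sv_plus_scale_Id_iff:
  "y \<in> sv_plus B (sv_scale c sv_Id) x \<longleftrightarrow> y - c *\<^sub>R x \<in> B x"
  by (force simp: sv_plus_def sv_scale_def sv_Id_def set_plus_def)

lemma mem_sv_minus_scale_Id_iff:
  "y \<in> sv_minus B (sv_scale c sv_Id) x \<longleftrightarrow> y + c *\<^sub>R x \<in> B x"
  by (force simp: sv_minus_def sv_plus_def sv_scale_def sv_Id_def set_plus_def)

lemma mem_sv_sum_scale_iff:
  assumes "finite I"
  shows "x \<in> sv_sum (\<lambda>i. sv_scale (w i) (B i)) I u \<longleftrightarrow>
    (\<exists>a. x = (\<Sum>i\<in>I. w i *\<^sub>R a i) \<and> (\<forall>i\<in>I. a i \<in> B i u))"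
proof
  assume "x \<in> sv_sum (\<lambda>i. sv_scale (w i) (B i)) I u"
  then obtain s where x: "x = sum s I" and s: "\<forall>i\<in>I. s i \<in> (\<lambda>v. w i *\<^sub>R v) ` B i u"
    unfolding sv_sum_def sv_scale_def set_sum_alt[OF assms] by blast
  from s have "\<forall>i\<in>I. \<exists>v. s i = w i *\<^sub>R v \<and> v \<in> B i u"
    by blast
  then obtain a where "\<forall>i\<in>I. s i = w i *\<^sub>R a i \<and> a i \<in> B i u"
    by metis
  with x show "\<exists>a. x = (\<Sum>i\<in>I. w i *\<^sub>R a i) \<and> (\<forall>i\<in>I. a i \<in> B i u)"
    by (intro exI[of _ a]) simp
next
  assume "\<exists>a. x = (\<Sum>i\<in>I. w i *\<^sub>R a i) \<and> (\<forall>i\<in>I. a i \<in> B i u)"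
  then show "x \<in> sv_sum (\<lambda>i. sv_scale (w i) (B i)) I u"
    unfolding sv_sum_def sv_scale_def set_sum_alt[OF assms] by blast
qed

lemma mem_resolvent_average_iff:
  "y \<in> resolvent_average n \<nu> B w x \<longleftrightarrow>
    (\<exists>a. x = (\<Sum>i\<in>{1..n}. w i *\<^sub>R a i) \<and>
         (\<forall>i\<in>{1..n}. y + inverse \<nu> *\<^sub>R (x - a i) \<in> B i (a i)))"
  unfolding resolvent_average_def
  by (simp add: mem_sv_minus_scale_Id_iff mem_sv_inverse_iff mem_sv_sum_scale_iff
      mem_sv_plus_scale_Id_iff algebra_simps)

lemma resolvent_average_sv_inverseI:
  assumes \<nu>: "\<nu> \<noteq> 0"
    and w: "(\<Sum>i\<in>{1..n}. w i) = 1"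
    and y: "y \<in> resolvent_average n \<nu> B w x"
  shows "x \<in> resolvent_average n (inverse \<nu>) (\<lambda>i. sv_inverse (B i)) w y"
proof -
  obtain a where x: "x = (\<Sum>i\<in>{1..n}. w i *\<^sub>R a i)"
    and a: "\<forall>i\<in>{1..n}. y + inverse \<nu> *\<^sub>R (x - a i) \<in> B i (a i)"
    using y by (auto simp: mem_resolvent_average_iff)
  define b where "b i = y + inverse \<nu> *\<^sub>R (x - a i)" for i
  have "(\<Sum>i\<in>{1..n}. w i *\<^sub>R (x - a i)) = 0"
    unfolding scaleR_diff_right sum_subtractf scaleR_left.sum[symmetric] w by (simp add: x)
  moreover have "(\<Sum>i\<in>{1..n}. w i *\<^sub>R b i) =
      (\<Sum>i\<in>{1..n}. w i) *\<^sub>R y + inverse \<nu> *\<^sub>R (\<Sum>i\<in>{1..n}. w i *\<^sub>R (x - a i))"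
    by (simp add: b_def scaleR_add_right sum.distrib scaleR_left.sum scaleR_right.sum
        mult.commute)
  ultimately have "y = (\<Sum>i\<in>{1..n}. w i *\<^sub>R b i)"
    unfolding w by simp
  moreover have "x + \<nu> *\<^sub>R (y - b i) = a i" for i
    using \<nu> by (simp add: b_def)
  ultimately show ?thesis
    using a by (auto simp: mem_resolvent_average_iff mem_sv_inverse_iff b_def intro!: exI[of _ b])
qed

theorem theorem2p2:
  fixes A :: "nat \<Rightarrow> 'a::{real_inner, complete_space} set_valued"
    and \<mu> :: real and n :: nat and w :: "nat \<Rightarrow> real"
  assumes "\<mu> > 0"
    and "n \<ge> 1"
    and "\<And>i. i \<in> {1..n} \<Longrightarrow> w i > 0"
    and "(\<Sum>i\<in>{1..n}. w i) = 1"
  shows "sv_inverse (resolvent_average n \<mu> A w)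
       = resolvent_average n (inverse \<mu>) (\<lambda>i. sv_inverse (A i)) w"
proof -
  have "y \<in> resolvent_average n \<mu> A w x \<longleftrightarrow>
      x \<in> resolvent_average n (inverse \<mu>) (\<lambda>i. sv_inverse (A i)) w y" for x y
    using resolvent_average_sv_inverseI[of \<mu> w n y A x]
      resolvent_average_sv_inverseI[of "inverse \<mu>" w n x "\<lambda>i. sv_inverse (A i)" y] assms(1,4)
    by (auto simp: sv_inverse_sv_inverse)
  then show ?thesis
    by (auto simp: fun_eq_iff mem_sv_inverse_iff)
qed

end
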